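(* The construction of $g$ from a seed function $H$ by $g(y)=H(y)-H(y-1)$ for every $y\in\mathbb{R}$ is reversible: $H$ may be retrieved from $g$ by $$H(y)=\sum_{\ell=0}^{\infty} g(y-\ell)\qquad\text{for any } y\in\mathbb{R}.$$ Hence there is a one-to-one map between seed functions and probability density functions with uniform generators (that is, $H\mapsto g$ is a one-to-one correspondence between the set of seed functions $H:\mathbb{R}\to[0,1]$ and the set of probability density functions $g:\mathbb{R}\to[0,\infty)$ whose associated generator is uniform, with inverse given by the displayed formula).
   Context: A seed function is a function $H:\mathbb{R}\to[0,1]$ with the following three properties: (1) $H(y-1)\le H(y)$ for all $y\in\mathbb{R}$; (2) $H(y)\to 0$ as $y\to-\infty$; (3) $H(y)\to 1$ as $y\to+\infty$. A probability density function is a function $g:\mathbb{R}\to[0,\infty)$ with $\int_{-\infty}^{\infty} g(y)\,dy=1$. A generator is a vector of functions $(g_k)_{k\in\mathbb{Z}}$, each mapping $[0,1)$ into $[0,\infty)$. A generator is uniform if $\sum_{k\in\mathbb{Z}} g_k(u)=1$ for all $u\in[0,1)$, where the convergence of this series of functions of $u$ is assumed to be uniform. The generator associated with a probability density function $g$ is given by $g_k(u)=g(k+u)$ for every $k\in\mathbb{Z}$ and $u\in[0,1)$.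
   Formalization: In the one-to-one correspondence, seed functions are required to be Lebesgue measurable, since a non-measurable seed function gives a non-measurable g whose integral is undefined; the retrieval formula is proved for all seed functions. *)

theory Defs
  imports "HOL-Analysis.Analysis"
begin

definition seed_function :: "(real \<Rightarrow> real) \<Rightarrow> bool" where
  "seed_function H \<longleftrightarrow>
     (\<forall>y. H y \<in> {0..1}) \<and>
     (\<forall>y. H (y - 1) \<le> H y) \<and>
     (H \<longlongrightarrow> 0) at_bot \<and>
     (H \<longlongrightarrow> 1) at_top"

(* The integral is the Lebesgue integral; has_bochner_integral includes Lebesgue
   measurability of g. *)
definition prob_density :: "(real \<Rightarrow> real) \<Rightarrow> bool" where
  "prob_density g \<longleftrightarrow> (\<forall>y. 0 \<le> g y) \<and> has_bochner_integral lebesgue g 1"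

(* A generator is a family indexed by the integers; only the values on [0,1) matter. *)
definition generator :: "(int \<Rightarrow> real \<Rightarrow> real) \<Rightarrow> bool" where
  "generator G \<longleftrightarrow> (\<forall>k. \<forall>u\<in>{0..<1}. 0 \<le> G k u)"

(* The two-sided series is the limit of its finite partial sums, as in has_sum,
   but uniformly in u; the terms are nonnegative, so the order of summation is
   immaterial. *)
definition uniform_generator :: "(int \<Rightarrow> real \<Rightarrow> real) \<Rightarrow> bool" where
  "uniform_generator G \<longleftrightarrow> generator G \<and>
     uniform_limit {0..<1} (\<lambda>K u. \<Sum>k\<in>K. G k u) (\<lambda>u. 1) (finite_subsets_at_top UNIV)"

definition assoc_generator :: "(real \<Rightarrow> real) \<Rightarrow> int \<Rightarrow> real \<Rightarrow> real" where
  "assoc_generator g k u = g (of_int k + u)"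

definition density_of_seed :: "(real \<Rightarrow> real) \<Rightarrow> real \<Rightarrow> real" where
  "density_of_seed H y = H y - H (y - 1)"

(* Measurability is the implicit convention under which the difference of a seed
   function has an integral: a non-measurable seed function has a non-measurable
   difference. *)
definition seed_functions :: "(real \<Rightarrow> real) set" where
  "seed_functions = {H. seed_function H \<and> H \<in> borel_measurable lebesgue}"

definition uniform_densities :: "(real \<Rightarrow> real) set" where
  "uniform_densities = {g. prob_density g \<and> uniform_generator (assoc_generator g)}"

end

theory Submission
  imports Defs
begin

text \<open>
  The map from \<^term>\<open>H\<close> to \<^term>\<open>g y = H y - H (y - 1)\<close> is a difference along each orbit
  \<^term>\<open>y + k\<close> of the integer translations, so all sums of values of \<^term>\<open>g\<close> along an orbit
  telescope. Since \<^term>\<open>H\<close> tends to \<open>0\<close> at \<open>-\<infinity>\<close>, the backward sums of \<^term>\<open>g\<close> recover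
  \<^term>\<open>H\<close> (\<open>density_of_seed_sums\<close>), which gives injectivity.

  A sum of \<^term>\<open>g\<close> over the block of integers from \<open>a\<close> to \<open>b - 1\<close> is a difference of two values
  of \<^term>\<open>H\<close>, one taken near \<open>b\<close> and one near \<open>a\<close>. The offset \<open>u\<close> in the unit interval moves
  these points by less than 1, so the limits of \<^term>\<open>H\<close> at infinity make the series converge to
  1 uniformly in \<open>u\<close> (\<open>uniform_generator_density_of_seed\<close>). The integral of a
  measurable \<^term>\<open>g\<close> is then 1: cutting the line into unit intervals and interchanging sum and integral,
  the integral of \<^term>\<open>g\<close> equals the integral over the unit interval of the constant 1
  (\<open>prob_density_if_uniform_generator\<close>).

  Conversely, given a density with uniform generator, its backward sums define a function
  \<^term>\<open>H\<close> whose unit difference is \<^term>\<open>g\<close>. Uniformity supplies, for each \<open>e > 0\<close>, one block of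
  integers that carries more than \<open>1 - e\<close> of the total mass 1 of every orbit. Far to the left
  the backward sum misses this block, so \<^term>\<open>H\<close> is at most \<open>e\<close>; far to the right it contains
  the block, so \<^term>\<open>H\<close> exceeds \<open>1 - e\<close> (\<open>seed_of_density\<close>). This is where convergence that is
  merely pointwise in \<open>u\<close> would not be enough.
\<close>

section \<open>Telescoping along integer translates\<close>

lemma measurable_lebesgue_shift:
  fixes f :: "real \<Rightarrow> real"
  assumes "f \<in> borel_measurable lebesgue"
  shows "(\<lambda>x. f (c + x)) \<in> borel_measurable lebesgue"
proof -
  have "(\<lambda>x. c + x) \<in> lebesgue \<rightarrow>\<^sub>M lebesgue"
    using lebesgue_affine_measurable[of "\<lambda>_::real. 1" c] by simp
  from measurable_compose[OF this assms] show ?thesis .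
qed

lemma density_of_seed_sums:
  assumes "(H \<longlongrightarrow> 0) at_bot"
  shows "(\<lambda>l::nat. density_of_seed H (y - real l)) sums H y"
proof -
  have "filterlim (\<lambda>n::nat. y - real n) at_bot sequentially"
    unfolding filterlim_uminus_at_bot
    using filterlim_tendsto_add_at_top[OF tendsto_const[of "- y"] filterlim_real_sequentially]
    by simp
  then have "(\<lambda>n::nat. H (y - real n)) \<longlonglongrightarrow> 0"
    by (rule filterlim_compose[OF assms])
  from telescope_sums'[OF this] show ?thesis
    by (simp add: density_of_seed_def algebra_simps)
qed

text \<open>
  The finite, two-sided counterpart of the telescoping series: the source of every estimate on finite
  partial sums of the generator.
\<close>
lemma sum_density_of_seed_block:
  assumes "a \<le> b"
  shows "(\<Sum>k\<in>{a..<b}. density_of_seed H (of_int k + u)) = H (of_int b - 1 + u) - H (of_int a - 1 + u)"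
  using assms
proof (induction b rule: int_ge_induct)
  case base
  then show ?case by simp
next
  case (step b)
  have "{a..<b+1} = insert b {a..<b}" using step.hyps by auto
  then show ?case using step by (simp add: density_of_seed_def algebra_simps)
qed

section \<open>From seed functions to uniform densities\<close>

lemma finite_int_subset_interval:
  fixes K :: "int set"
  assumes "finite K"
  obtains a b where "K \<subseteq> {a..b}" "a \<le> b"
proof -
  define M where "M = Max (insert 0 (abs ` K))"
  have "\<bar>k\<bar> \<le> M" if "k \<in> K" for k
    unfolding M_def using assms that by (intro Max_ge) auto
  moreover have "0 \<le> M"
    unfolding M_def using assms by (intro Max_ge) auto
  ultimately show thesis
    by (intro that[of "- M" M]) (auto simp: abs_le_iff minus_le_iff)
qed

text \<open>
  The terms are nonnegative, so partial sums increase with the index set. Every finite index set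
  lies in a block, which bounds its sum by 1; every index set that contains one large block has a
  sum close to 1. Uniformity in \<open>u\<close> holds because the ends of that block are rounded outwards
  far enough that every offset passes the thresholds for the limits of \<^term>\<open>H\<close>.
\<close>
lemma uniform_generator_density_of_seed:
  assumes "seed_function H"
  shows "uniform_generator (assoc_generator (density_of_seed H))"
proof -
  define G where "G = assoc_generator (density_of_seed H)"
  have H01: "0 \<le> H y" "H y \<le> 1" and mono: "H (y - 1) \<le> H y" for y
    using assms by (auto simp: seed_function_def)
  have bot: "(H \<longlongrightarrow> 0) at_bot" and top: "(H \<longlongrightarrow> 1) at_top"
    using assms by (auto simp: seed_function_def)
  have G0: "0 \<le> G k u" for k u
    using mono by (simp add: G_def assoc_generator_def density_of_seed_def)
  have block: "(\<Sum>k\<in>{a..<b}. G k u) = H (of_int b - 1 + u) - H (of_int a - 1 + u)" if "a \<le> b" for a b u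
    using sum_density_of_seed_block[OF that] by (simp add: G_def assoc_generator_def)
  have le1: "(\<Sum>k\<in>K. G k u) \<le> 1" if "finite K" for K u
  proof -
    obtain a b where ab: "K \<subseteq> {a..b}" "a \<le> b"
      by (rule finite_int_subset_interval[OF \<open>finite K\<close>])
    then have "K \<subseteq> {a..<b + 1}" by auto
    then have "(\<Sum>k\<in>K. G k u) \<le> (\<Sum>k\<in>{a..<b + 1}. G k u)"
      by (intro sum_mono2) (auto simp: G0)
    also have "\<dots> \<le> 1"
      using block[of a "b + 1" u] ab(2) H01[of "of_int b + u"] H01[of "of_int a - 1 + u"] by simp
    finally show ?thesis .
  qed
  have "\<forall>\<^sub>F K in finite_subsets_at_top UNIV. \<forall>u\<in>{0..<1}. dist (\<Sum>k\<in>K. G k u) 1 < e" if "e > 0" for e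
  proof -
    have "\<forall>\<^sub>F y in at_bot. H y < e/2" "\<forall>\<^sub>F y in at_top. H y > 1 - e/2"
      using order_tendstoD(2)[OF bot, of "e/2"] order_tendstoD(1)[OF top, of "1 - e/2"] that by auto
    then obtain p q where p: "\<And>y. y \<le> p \<Longrightarrow> H y < e/2" and q: "\<And>y. y \<ge> q \<Longrightarrow> H y > 1 - e/2"
      unfolding eventually_at_bot_linorder eventually_at_top_linorder by blast
    \<comment> \<open>The minimum and maximum with 0 only ensure that the block is nonempty.\<close>
    define a where "a = min 0 \<lfloor>p\<rfloor>"
    define b where "b = max 0 \<lceil>q\<rceil> + 1"
    have ab: "a \<le> b" by (simp add: a_def b_def)
    show ?thesis
      unfolding eventually_finite_subsets_at_top
    proof (intro exI[of _ "{a..<b}"] conjI allI impI ballI)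
      fix K u assume K: "finite K \<and> {a..<b} \<subseteq> K \<and> K \<subseteq> UNIV" and u: "u \<in> {0..<1::real}"
      have ap: "of_int a - 1 + u \<le> p"
      proof -
        have "of_int a \<le> (of_int \<lfloor>p\<rfloor> :: real)" by (simp add: a_def)
        moreover have "u < 1" using u by simp
        ultimately show ?thesis using of_int_floor_le[of p] by linarith
      qed
      have bq: "of_int b - 1 + u \<ge> q"
      proof -
        have "of_int b - 1 \<ge> (of_int \<lceil>q\<rceil> :: real)" by (simp add: b_def)
        moreover have "0 \<le> u" using u by simp
        ultimately show ?thesis using le_of_int_ceiling[of q] by linarith
      qed
      have "1 - e < (\<Sum>k\<in>{a..<b}. G k u)"
        using block[OF ab, of u] p[OF ap] q[OF bq] by simp
      also have "\<dots> \<le> (\<Sum>k\<in>K. G k u)"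
        using K by (intro sum_mono2) (auto simp: G0)
      finally show "dist (\<Sum>k\<in>K. G k u) 1 < e"
        using le1[of K u] K by (simp add: dist_real_def)
    qed auto
  qed
  then have "uniform_limit {0..<1} (\<lambda>K u. \<Sum>k\<in>K. G k u) (\<lambda>u. 1) (finite_subsets_at_top UNIV)"
    unfolding uniform_limit_iff by blast
  with G0 show ?thesis
    unfolding uniform_generator_def generator_def G_def by blast
qed

lemma uniform_generator_has_sum:
  assumes "uniform_generator G" "u \<in> {0..<1}"
  shows "((\<lambda>k. G k u) has_sum 1) UNIV"
  using assms tendsto_uniform_limitI[where x = u and S = "{0..<1}"]
  unfolding uniform_generator_def has_sum_def by fast

text \<open>
  Countable additivity is phrased for series over the natural numbers, so the integers are
  enumerated; summability over finite subsets makes the enumeration irrelevant.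
\<close>
lemma uniform_generator_sums:
  assumes "uniform_generator G" "u \<in> {0..<1}"
  shows "(\<lambda>n. G (int_decode n) u) sums 1"
proof -
  have "((\<lambda>n. G (int_decode n) u) has_sum 1) UNIV"
    using uniform_generator_has_sum[OF assms]
    by (subst has_sum_reindex_bij_betw[OF bij_int_decode, where f = "\<lambda>k. G k u"])
  then show ?thesis by (rule has_sum_imp_sums)
qed

text \<open>
  The line is the disjoint union of the unit intervals starting at integers. Translating each of
  them to the unit interval and summing under the integral sign (Tonelli) leaves the integral of
  the pointwise sum of the generator, which is 1.
\<close>
lemma prob_density_if_uniform_generator:
  assumes gen: "uniform_generator (assoc_generator g)" and meas: "g \<in> borel_measurable lebesgue"
    and nn: "\<And>y. 0 \<le> g y"
  shows "prob_density g"
proof -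
  define B where "B n = {of_int (int_decode n) ..< of_int (int_decode n) + (1::real)}" for n
  have mem: "x \<in> B n \<longleftrightarrow> \<lfloor>x\<rfloor> = int_decode n" for x n
    unfolding B_def by (auto simp: floor_eq_iff)
  have "disjoint_family B"
    unfolding disjoint_family_on_def using mem by (auto dest: injD[OF inj_int_decode])
  have UB: "(\<Union>n. B n) = UNIV"
    using mem by (metis UNIV_eq_I UN_iff UNIV_I int_encode_inverse)
  have gm: "(\<lambda>x. ennreal (g x)) \<in> borel_measurable lebesgue" using meas by measurable
  have Bm: "B n \<in> sets lebesgue" for n unfolding B_def by simp
  have sm: "(\<lambda>u. ennreal (g (c + u)) * indicator {0..<1} u) \<in> borel_measurable lebesgue" for c
    using measurable_lebesgue_shift[OF meas, of c]
    by (intro borel_measurable_times_ennreal borel_measurable_indicator measurable_compose[OF _ measurable_ennreal]) auto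
  have "(\<integral>\<^sup>+x. ennreal (g x) \<partial>lebesgue) = (\<integral>\<^sup>+x\<in>(\<Union>n. B n). ennreal (g x) \<partial>lebesgue)"
    by (simp add: UB)
  also have "\<dots> = (\<Sum>n. \<integral>\<^sup>+x\<in>B n. ennreal (g x) \<partial>lebesgue)"
    by (rule nn_integral_disjoint_family[OF gm Bm \<open>disjoint_family B\<close>])
  also have "\<dots> = (\<Sum>n. \<integral>\<^sup>+u\<in>{0..<1}. ennreal (g (of_int (int_decode n) + u)) \<partial>lebesgue)"
  proof (rule suminf_cong)
    fix n
    have ind: "indicator (B n) (of_int (int_decode n) + u) = (indicator {0..<1} u :: ennreal)" for u
      by (simp add: B_def indicator_def)
    have "(\<integral>\<^sup>+x\<in>B n. ennreal (g x) \<partial>lebesgue) =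
       ennreal \<bar>1\<bar> * (\<integral>\<^sup>+u. ennreal (g (of_int (int_decode n) + 1 * u)) * indicator (B n) (of_int (int_decode n) + 1 * u) \<partial>lebesgue)"
      using gm Bm by (intro nn_integral_real_affine_lebesgue) auto
    then show "(\<integral>\<^sup>+x\<in>B n. ennreal (g x) \<partial>lebesgue) =
      (\<integral>\<^sup>+u\<in>{0..<1}. ennreal (g (of_int (int_decode n) + u)) \<partial>lebesgue)"
      by (simp add: ind)
  qed
  also have "\<dots> = (\<integral>\<^sup>+u. (\<Sum>n. ennreal (g (of_int (int_decode n) + u)) * indicator {0..<1} u) \<partial>lebesgue)"
    by (rule nn_integral_suminf[symmetric, OF sm])
  also have "\<dots> = (\<integral>\<^sup>+u. indicator {0..<1::real} u \<partial>lebesgue)"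
  proof (rule nn_integral_cong)
    fix u :: real
    show "(\<Sum>n. ennreal (g (of_int (int_decode n) + u)) * indicator {0..<1} u) = indicator {0..<1} u"
    proof (cases "u \<in> {0..<1}")
      case True
      then show ?thesis
        using uniform_generator_sums[OF gen True] nn
        by (simp add: assoc_generator_def suminf_ennreal_eq sums_unique[symmetric])
    qed simp
  qed
  also have "\<dots> = 1" by simp
  finally have "has_bochner_integral lebesgue g 1"
    using meas nn by (intro has_bochner_integral_nn_integral) auto
  then show ?thesis using nn by (simp add: prob_density_def)
qed

lemma density_of_seed_mem:
  assumes "H \<in> seed_functions"
  shows "density_of_seed H \<in> uniform_densities"
proof -
  have H: "seed_function H" and meas: "H \<in> borel_measurable lebesgue"
    using assms by (auto simp: seed_functions_def)
  have "(\<lambda>y. H (-1 + y)) \<in> borel_measurable lebesgue"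
    by (rule measurable_lebesgue_shift[OF meas])
  then have "(\<lambda>y. H y - H (-1 + y)) \<in> borel_measurable lebesgue"
    using meas by measurable
  then have "density_of_seed H \<in> borel_measurable lebesgue"
    by (simp add: density_of_seed_def[abs_def])
  moreover have "0 \<le> density_of_seed H y" for y
    using H by (simp add: density_of_seed_def seed_function_def)
  ultimately show ?thesis
    using uniform_generator_density_of_seed[OF H] prob_density_if_uniform_generator
    by (auto simp: uniform_densities_def)
qed

section \<open>From uniform densities to seed functions\<close>

text \<open>
  Turns the partial sums of the inversion formula into sums of the generator over blocks of
  integers, to which the uniform convergence applies.
\<close>
lemma partial_sum_shifts_eq_block:
  fixes g :: "real \<Rightarrow> real"
  shows "(\<Sum>l<n. g (of_int m + u - real l)) = (\<Sum>k\<in>{m - int n<..m}. assoc_generator g k u)"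
proof (rule sum.reindex_bij_witness[where i = "\<lambda>k. nat (m - k)" and j = "\<lambda>l. m - int l"])
qed (auto simp: assoc_generator_def algebra_simps)

text \<open>
  Surjectivity. The bounds and both limits are read off from block sums: the mass of each orbit is
  1, and a single block carries almost all of it on every orbit at once.
\<close>
lemma seed_of_density:
  assumes "g \<in> uniform_densities"
  obtains H where "H \<in> seed_functions" "\<And>y. (\<lambda>l::nat. g (y - real l)) sums H y"
    "density_of_seed H = g"
proof -
  define G where "G = assoc_generator g"
  have nn: "0 \<le> g y" and meas: "g \<in> borel_measurable lebesgue" and gen: "uniform_generator G" for y
    using assms by (auto simp: uniform_densities_def prob_density_def G_def has_bochner_integral_iff)
  have G0: "0 \<le> G k u" for k u by (simp add: G_def assoc_generator_def nn)
  have le1: "(\<Sum>k\<in>K. G k u) \<le> 1" if "finite K" "u \<in> {0..<1}" for K u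
    using that G0 finite_sum_le_has_sum[OF uniform_generator_has_sum[OF gen that(2)]] by auto
  have part: "(\<Sum>l<n. g (y - real l)) = (\<Sum>k\<in>{\<lfloor>y\<rfloor> - int n<..\<lfloor>y\<rfloor>}. G k (frac y))" for y n
    using partial_sum_shifts_eq_block[of g "\<lfloor>y\<rfloor>" "frac y" n] by (simp add: frac_def G_def)
  have fr: "frac y \<in> {0..<1}" for y :: real by (simp add: frac_lt_1)
  define H where "H y = (\<Sum>l::nat. g (y - real l))" for y
  have summ: "summable (\<lambda>l::nat. g (y - real l))" for y
    by (rule summableI_nonneg_bounded[of _ 1]) (auto simp: nn part intro!: le1 fr)
  then have sums: "(\<lambda>l::nat. g (y - real l)) sums H y" for y
    unfolding H_def by (rule summable_sums)
  have partle: "(\<Sum>l<n. g (y - real l)) \<le> H y" for y n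
    unfolding H_def by (rule sum_le_suminf[OF summ]) (auto simp: nn)
  have Hle: "H y \<le> c" if "\<And>n. (\<Sum>l<n. g (y - real l)) \<le> c" for y c
    unfolding H_def by (rule suminf_le_const[OF summ that])
  have H0: "0 \<le> H y" for y using partle[where n=0] by simp
  have H1: "H y \<le> 1" for y by (rule Hle) (auto simp: part intro!: le1 fr)
  have dens: "density_of_seed H y = g y" for y
  proof -
    have "(\<lambda>l::nat. g (y - real (Suc l))) sums (H y - g y)"
      using sums[of y] by (subst sums_Suc_iff) simp
    moreover have "(\<lambda>l::nat. g (y - real (Suc l))) sums H (y - 1)"
      using sums[of "y - 1"] by (simp add: algebra_simps)
    ultimately show ?thesis using sums_unique2 by (fastforce simp: density_of_seed_def)
  qed
  have ex: "\<exists>a b. \<forall>u\<in>{0..<1}. (\<Sum>k\<in>{a..b}. G k u) > 1 - e" if "e > 0" for e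
  proof -
    have "\<forall>\<^sub>F K in finite_subsets_at_top UNIV. \<forall>u\<in>{0..<1}. dist (\<Sum>k\<in>K. G k u) 1 < e"
      using gen that unfolding uniform_generator_def uniform_limit_iff by blast
    then obtain K where "finite K"
      and K': "\<forall>Y. finite Y \<and> K \<subseteq> Y \<and> Y \<subseteq> UNIV \<longrightarrow> (\<forall>u\<in>{0..<1}. dist (\<Sum>k\<in>Y. G k u) 1 < e)"
      unfolding eventually_finite_subsets_at_top by auto
    from K'[rule_format, of K] \<open>finite K\<close>
    have K: "dist (\<Sum>k\<in>K. G k u) 1 < e" if "u \<in> {0..<1}" for u
      using that by simp
    obtain a b where "K \<subseteq> {a..b}"
      using finite_int_subset_interval[OF \<open>finite K\<close>] by blast
    then have "(\<Sum>k\<in>{a..b}. G k u) > 1 - e" if "u \<in> {0..<1}" for u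
      using K[OF that] sum_mono2[of "{a..b}" K "\<lambda>k. G k u"] G0 by (auto simp: dist_real_def)
    then show ?thesis by blast
  qed
  have bot: "(H \<longlongrightarrow> 0) at_bot"
  proof (rule tendstoI)
    fix e :: real assume "e > 0"
    then obtain a b where ab: "\<And>u. u \<in> {0..<1} \<Longrightarrow> (\<Sum>k\<in>{a..b}. G k u) > 1 - e/2"
      using ex[of "e/2"] by (meson half_gt_zero)
    \<comment> \<open>The partial sums of \<^term>\<open>H y\<close> range over integers disjoint from the heavy block, and both
      together have mass at most 1.\<close>
    have "H y \<le> e/2" if "y < of_int a" for y
    proof (rule Hle)
      fix n
      define F where "F = {\<lfloor>y\<rfloor> - int n<..\<lfloor>y\<rfloor>}"
      have "F \<inter> {a..b} = {}" using that by (auto simp: F_def le_floor_iff)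
      then have "(\<Sum>k\<in>F. G k (frac y)) + (\<Sum>k\<in>{a..b}. G k (frac y)) = (\<Sum>k\<in>F \<union> {a..b}. G k (frac y))"
        by (intro sum.union_disjoint[symmetric]) (auto simp: F_def)
      also have "\<dots> \<le> 1" by (intro le1 fr) (auto simp: F_def)
      finally show "(\<Sum>l<n. g (y - real l)) \<le> e/2"
        using ab[OF fr[of y]] by (simp add: part F_def)
    qed
    then have "\<forall>y<of_int a. dist (H y) 0 < e" using \<open>e > 0\<close> H0 by (force simp: dist_real_def)
    then show "\<forall>\<^sub>F y in at_bot. dist (H y) 0 < e"
      unfolding eventually_at_bot_dense by blast
  qed
  have top: "(H \<longlongrightarrow> 1) at_top"
  proof (rule tendstoI)
    fix e :: real assume "e > 0"
    then obtain a b where ab: "\<And>u. u \<in> {0..<1} \<Longrightarrow> (\<Sum>k\<in>{a..b}. G k u) > 1 - e"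
      using ex[of e] by meson
    have "H y > 1 - e" if "y > of_int b" for y
    proof -
      define n where "n = nat (\<lfloor>y\<rfloor> - a + 1)"
      have "b \<le> \<lfloor>y\<rfloor>" using that by (simp add: le_floor_iff)
      then have "{a..b} \<subseteq> {\<lfloor>y\<rfloor> - int n<..\<lfloor>y\<rfloor>}" by (auto simp: n_def)
      then have "(\<Sum>k\<in>{a..b}. G k (frac y)) \<le> (\<Sum>l<n. g (y - real l))"
        unfolding part by (intro sum_mono2) (auto simp: G0)
      then show ?thesis using ab[OF fr[of y]] partle[where n=n and y=y] by linarith
    qed
    then have "\<forall>y>of_int b. dist (H y) 1 < e"
      using H1 \<open>e > 0\<close> by (force simp: dist_real_def)
    then show "\<forall>\<^sub>F y in at_top. dist (H y) 1 < e"
      unfolding eventually_at_top_dense by blast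
  qed
  have "(\<lambda>y. g (y - real l)) \<in> borel_measurable lebesgue" for l
    using measurable_lebesgue_shift[OF meas, of "- real l"] by simp
  then have "H \<in> borel_measurable lebesgue"
    unfolding H_def[abs_def] by (intro borel_measurable_suminf)
  moreover have "H (y - 1) \<le> H y" for y
    using dens[of y] nn[of y] by (simp add: density_of_seed_def)
  ultimately have "H \<in> seed_functions"
    using H0 H1 bot top by (auto simp: seed_functions_def seed_function_def)
  then show thesis using that sums dens by blast
qed

section \<open>The correspondence\<close>

theorem mainTheorem4:
  shows "(\<forall>H. seed_function H \<longrightarrow>
            (\<forall>y. (\<lambda>l::nat. density_of_seed H (y - real l)) sums H y)) \<and>
         bij_betw density_of_seed seed_functions uniform_densities \<and>
         (\<forall>g\<in>uniform_densities. \<forall>y.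
            (\<lambda>l::nat. g (y - real l)) sums the_inv_into seed_functions density_of_seed g y)"
proof -
  have sums: "(\<lambda>l::nat. density_of_seed H (y - real l)) sums H y" if "seed_function H" for H y
    using that density_of_seed_sums by (simp add: seed_function_def)
  have inj: "inj_on density_of_seed seed_functions"
  proof (rule inj_onI, rule ext)
    fix H H' y
    assume "H \<in> seed_functions" "H' \<in> seed_functions" "density_of_seed H = density_of_seed H'"
    then show "H y = H' y"
      using sums[of H y] sums[of H' y] by (auto simp: seed_functions_def intro: sums_unique2)
  qed
  have "density_of_seed ` seed_functions = uniform_densities"
  proof (intro equalityI subsetI)
    fix g assume "g \<in> uniform_densities"
    then show "g \<in> density_of_seed ` seed_functions"
      by (rule seed_of_density) auto
  qed (auto simp: density_of_seed_mem)
  with inj have bij: "bij_betw density_of_seed seed_functions uniform_densities"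
    by (simp add: bij_betw_def)
  have "(\<lambda>l::nat. g (y - real l)) sums the_inv_into seed_functions density_of_seed g y"
    if g: "g \<in> uniform_densities" for g y
  proof (rule seed_of_density[OF g])
    fix H assume H: "H \<in> seed_functions" "\<And>y. (\<lambda>l::nat. g (y - real l)) sums H y" "density_of_seed H = g"
    then have "the_inv_into seed_functions density_of_seed g = H"
      using the_inv_into_f_eq[OF inj] by blast
    with H(2) show ?thesis by simp
  qed
  with sums bij show ?thesis by blast
qed

end
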